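(* Let $n$ be a positive integer, let $R$ be an $n$-OAF-ring and let $I$ be a proper ideal of $R$. Then $R/I$ is an $n$-OAF-ring.
   Context: All rings are commutative with $1\neq 0$. A proper ideal $I$ of a ring $R$ is an $n$-OA ideal if whenever $a_1a_2\cdots a_{n+1}\in I$ for nonunits $a_1,\ldots,a_{n+1}\in R$, then $a_1a_2\cdots a_n\in I$ or $a_{n+1}\in I$. A ring $R$ is an $n$-OAF-ring if every proper ideal of $R$ is a product of finitely many $n$-OA ideals of $R$. *)

theory Defs
  imports "HOL-Algebra.Algebra"
begin

definition proper_ideal :: "'a set \<Rightarrow> ('a, 'b) ring_scheme \<Rightarrow> bool" where
  "proper_ideal I R \<longleftrightarrow> ideal I R \<and> I \<noteq> carrier R"

definition n_OA_ideal :: "nat \<Rightarrow> 'a set \<Rightarrow> ('a, 'b) ring_scheme \<Rightarrow> bool" where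
  "n_OA_ideal n I R \<longleftrightarrow> proper_ideal I R \<and>
     (\<forall>a \<in> {1..n+1} \<rightarrow> carrier R - Units R.
        (\<Otimes>\<^bsub>R\<^esub>i\<in>{1..n+1}. a i) \<in> I \<longrightarrow>
        (\<Otimes>\<^bsub>R\<^esub>i\<in>{1..n}. a i) \<in> I \<or> a (n+1) \<in> I)"

text \<open>The empty product of ideals is the unit ideal \<open>carrier R\<close>. It is not proper, so the
  factorizations of a proper ideal are necessarily nonempty.\<close>

definition ideal_list_prod :: "('a, 'b) ring_scheme \<Rightarrow> 'a set list \<Rightarrow> 'a set" where
  "ideal_list_prod R Js = foldr (ideal_prod R) Js (carrier R)"

definition n_OAF_ring :: "nat \<Rightarrow> ('a, 'b) ring_scheme \<Rightarrow> bool" where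
  "n_OAF_ring n R \<longleftrightarrow> cring R \<and> \<one>\<^bsub>R\<^esub> \<noteq> \<zero>\<^bsub>R\<^esub> \<and>
     (\<forall>I. proper_ideal I R \<longrightarrow>
        (\<exists>Js. (\<forall>J\<in>set Js. n_OA_ideal n J R) \<and> I = ideal_list_prod R Js))"

end

theory Submission
  imports Defs
begin

text \<open>
  The argument works for any surjective homomorphism \<open>h : R \<rightarrow> S\<close> of commutative rings with
  \<open>S\<close> nonzero; the quotient map is the case of interest. Let \<open>K\<close> be a proper ideal of \<open>S\<close>.
  Its preimage is a proper ideal of \<open>R\<close>, hence a product \<open>J\<^sub>1 \<cdots> J\<^sub>k\<close> of \<open>n\<close>-OA ideals.
  Surjectivity gives that \<open>K\<close> is the image of its preimage, and images commute with products of
  ideals (\<open>hom_image_ideal_list_prod\<close>), so \<open>K = h(J\<^sub>1) \<cdots> h(J\<^sub>k)\<close>.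

  It remains to see that each \<open>h(J\<^sub>i)\<close> is \<open>n\<close>-OA. A product of ideals lies in every factor, so
  each \<open>J\<^sub>i\<close> contains the preimage of \<open>K\<close> and in particular the kernel of \<open>h\<close>. For an ideal
  that contains the kernel, membership can be tested after applying \<open>h\<close>. Moreover \<open>h\<close> maps
  units to units, so any lift of a nonunit of \<open>S\<close> is a nonunit of \<open>R\<close>. Thus the \<open>n\<close>-OA
  condition for \<open>h(J\<^sub>i)\<close> follows from the one for \<open>J\<^sub>i\<close> by lifting the elements
  (\<open>n_OA_ideal_hom_image\<close>).
\<close>

lemma n_OA_ideal_imp_ideal: "n_OA_ideal n J R \<Longrightarrow> ideal J R"
  unfolding n_OA_ideal_def proper_ideal_def by (elim conjE)

lemma (in ring) ideal_list_prod_is_ideal: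
  assumes "\<forall>J\<in>set Js. ideal J R"
  shows "ideal (ideal_list_prod R Js) R"
  using assms unfolding ideal_list_prod_def
  by (induction Js) (auto intro: oneideal ideal_prod_is_ideal)

lemma (in ring) ideal_list_prod_subset_factor:
  assumes "\<forall>J\<in>set Js. ideal J R" and "J \<in> set Js"
  shows "ideal_list_prod R Js \<subseteq> J"
  using assms
proof (induction Js)
  case (Cons K Ks)
  have "ideal (ideal_list_prod R Ks) R"
    using Cons.prems by (intro ideal_list_prod_is_ideal) simp
  then have "ideal_list_prod R (K # Ks) \<subseteq> K \<inter> ideal_list_prod R Ks"
    using ideal_prod_inter[of K] Cons.prems(1) by (simp add: ideal_list_prod_def)
  then show ?case using Cons by auto
qed simp

lemma (in ring_hom_ring) hom_image_ideal_prod: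
  assumes "ideal I R" and "ideal J R"
  shows "h ` (I \<cdot>\<^bsub>R\<^esub> J) = (h ` I) \<cdot>\<^bsub>S\<^esub> (h ` J)"
proof (intro equalityI subsetI)
  have carr: "x \<in> carrier R" if "x \<in> I \<cdot>\<^bsub>R\<^esub> J" for x
    using that R.ideal_prod_in_carrier[OF assms] by blast
  have carrI: "x \<in> carrier R" if "x \<in> I" for x using assms(1) ideal.Icarr that by metis
  have carrJ: "x \<in> carrier R" if "x \<in> J" for x using assms(2) ideal.Icarr that by metis
  show "y \<in> (h ` I) \<cdot>\<^bsub>S\<^esub> (h ` J)" if "y \<in> h ` (I \<cdot>\<^bsub>R\<^esub> J)" for y
  proof -
    from that obtain x where x: "x \<in> I \<cdot>\<^bsub>R\<^esub> J" "y = h x" by blast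
    from x(1) have "h x \<in> (h ` I) \<cdot>\<^bsub>S\<^esub> (h ` J)"
    proof (induction rule: ideal_prod.induct)
      case (prod i j)
      then show ?case using carrI carrJ by (auto intro: ideal_prod.prod)
    next
      case (sum s t)
      then show ?case using carr by (auto intro: ideal_prod.sum)
    qed
    with x show ?thesis by simp
  qed
  show "y \<in> h ` (I \<cdot>\<^bsub>R\<^esub> J)" if "y \<in> (h ` I) \<cdot>\<^bsub>S\<^esub> (h ` J)" for y
    using that
  proof (induction rule: ideal_prod.induct)
    case (prod i j)
    then obtain a b where ab: "a \<in> I" "b \<in> J" "i = h a" "j = h b" by blast
    then have "i \<otimes>\<^bsub>S\<^esub> j = h (a \<otimes>\<^bsub>R\<^esub> b)" using carrI carrJ by simp
    then show ?case using ab by (auto intro: ideal_prod.prod)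
  next
    case (sum s t)
    then obtain a b where ab: "a \<in> I \<cdot>\<^bsub>R\<^esub> J" "b \<in> I \<cdot>\<^bsub>R\<^esub> J" "s = h a" "t = h b" by blast
    then have "s \<oplus>\<^bsub>S\<^esub> t = h (a \<oplus>\<^bsub>R\<^esub> b)" using carr by simp
    then show ?case using ab by (auto intro: ideal_prod.sum)
  qed
qed

text \<open>
  Surjectivity enters through the base of the fold: the image of the unit ideal has to be the
  unit ideal.
\<close>

lemma (in ring_hom_ring) hom_image_ideal_list_prod:
  assumes "h ` carrier R = carrier S" and "\<forall>J\<in>set Js. ideal J R"
  shows "h ` ideal_list_prod R Js = ideal_list_prod S (map ((`) h) Js)"
  using assms(2)
proof (induction Js)
  case Nil
  then show ?case using assms(1) by (simp add: ideal_list_prod_def)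
next
  case (Cons J Js)
  then show ?case
    using hom_image_ideal_prod[of J "ideal_list_prod R Js"] R.ideal_list_prod_is_ideal[of Js]
    by (simp add: ideal_list_prod_def)
qed

lemma (in ring_hom_ring) hom_image_ideal:
  assumes "h ` carrier R = carrier S" and "ideal J R"
  shows "ideal (h ` J) S"
proof (rule idealI)
  interpret J: ideal J R by fact
  show "ring S" by (rule S.ring_axioms)
  show "subgroup (h ` J) (add_monoid S)"
    by (rule img_is_add_subgroup) (rule J.a_subgroup)
  fix a x assume "a \<in> h ` J" "x \<in> carrier S"
  then obtain b y where lift: "b \<in> J" "a = h b" "y \<in> carrier R" "x = h y"
    using assms(1) by blast
  then have "x \<otimes>\<^bsub>S\<^esub> a = h (y \<otimes>\<^bsub>R\<^esub> b)" "a \<otimes>\<^bsub>S\<^esub> x = h (b \<otimes>\<^bsub>R\<^esub> y)" by simp_all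
  then show "x \<otimes>\<^bsub>S\<^esub> a \<in> h ` J" "a \<otimes>\<^bsub>S\<^esub> x \<in> h ` J"
    using lift J.I_l_closed J.I_r_closed by (metis imageI)+
qed

text \<open>
  Two elements with the same image differ by an element of the kernel, which \<open>J\<close> absorbs.
\<close>

lemma (in ring_hom_ring) hom_image_mem_iff:
  assumes "ideal J R" and "a_kernel R S h \<subseteq> J" and "x \<in> carrier R"
  shows "h x \<in> h ` J \<longleftrightarrow> x \<in> J"
proof
  interpret J: ideal J R by fact
  assume "h x \<in> h ` J"
  then obtain j where j: "j \<in> J" "h x = h j" by blast
  then have "x \<in> a_kernel R S h +>\<^bsub>R\<^esub> j"
    using homeq_imp_rcos[of j x] assms(3) by simp
  then obtain k where "k \<in> a_kernel R S h" "x = k \<oplus>\<^bsub>R\<^esub> j"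
    by (auto simp: a_r_coset_def')
  then show "x \<in> J" using j assms(2) by auto
qed blast

lemma (in ring_hom_ring) hom_Units:
  assumes "x \<in> Units R"
  shows "h x \<in> Units S"
proof -
  from assms obtain y where y: "x \<in> carrier R" "y \<in> carrier R"
      "y \<otimes>\<^bsub>R\<^esub> x = \<one>\<^bsub>R\<^esub>" "x \<otimes>\<^bsub>R\<^esub> y = \<one>\<^bsub>R\<^esub>"
    by (auto simp: Units_def)
  then have "h y \<otimes>\<^bsub>S\<^esub> h x = \<one>\<^bsub>S\<^esub>" "h x \<otimes>\<^bsub>S\<^esub> h y = \<one>\<^bsub>S\<^esub>"
    by (metis hom_mult hom_one)+
  with y show ?thesis by (auto simp: Units_def)
qed

text \<open>
  Nonunits of \<open>S\<close> lift to nonunits of \<open>R\<close>, so the \<open>n\<close>-OA condition for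
  \<open>J\<close> applies to the lifts, and the kernel condition transfers membership both ways.
\<close>

lemma (in ring_hom_cring) n_OA_ideal_hom_image:
  assumes surj: "h ` carrier R = carrier S"
    and OA: "n_OA_ideal n J R" and ker: "a_kernel R S h \<subseteq> J"
  shows "n_OA_ideal n (h ` J) S"
proof -
  have J: "ideal J R" "J \<noteq> carrier R" using OA by (auto simp: n_OA_ideal_def proper_ideal_def)
  note mem_iff = ring.hom_image_mem_iff[OF J(1) ker]
  show ?thesis
    unfolding n_OA_ideal_def proper_ideal_def
  proof (intro conjI ballI impI)
    show "ideal (h ` J) S" by (rule ring.hom_image_ideal[OF surj J(1)])
    show "h ` J \<noteq> carrier S"
    proof
      assume "h ` J = carrier S"
      then have "h \<one>\<^bsub>R\<^esub> \<in> h ` J" by simp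
      then show False
        using mem_iff[OF R.one_closed] ideal.one_imp_carrier[OF J(1)] J(2) by blast
    qed
    fix a assume a: "a \<in> {1..n+1} \<rightarrow> carrier S - Units S"
      and prod: "(\<Otimes>\<^bsub>S\<^esub>i\<in>{1..n+1}. a i) \<in> h ` J"
    have "\<forall>i\<in>{1..n+1}. \<exists>x. x \<in> carrier R \<and> h x = a i"
    proof
      fix i assume "i \<in> {1..n+1}"
      then have "a i \<in> h ` carrier R" using a surj by blast
      then show "\<exists>x. x \<in> carrier R \<and> h x = a i" by force
    qed
    then obtain b where b: "\<And>i. i \<in> {1..n+1} \<Longrightarrow> b i \<in> carrier R \<and> h (b i) = a i"
      by metis
    have nonunit: "b \<in> {1..n+1} \<rightarrow> carrier R - Units R"
    proof
      fix i assume i: "i \<in> {1..n+1}"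
      then have "h (b i) \<notin> Units S" using a b by (metis DiffD2 Pi_mem)
      then show "b i \<in> carrier R - Units R" using b[OF i] ring.hom_Units by blast
    qed
    have lift: "(\<Otimes>\<^bsub>R\<^esub>i\<in>A. b i) \<in> carrier R"
        "h (\<Otimes>\<^bsub>R\<^esub>i\<in>A. b i) = (\<Otimes>\<^bsub>S\<^esub>i\<in>A. a i)" if A: "A \<subseteq> {1..n+1}" for A
    proof -
      have b_carr: "b \<in> A \<rightarrow> carrier R" using b A by blast
      show "(\<Otimes>\<^bsub>R\<^esub>i\<in>A. b i) \<in> carrier R" by (rule R.finprod_closed[OF b_carr])
      have "h (\<Otimes>\<^bsub>R\<^esub>i\<in>A. b i) = (\<Otimes>\<^bsub>S\<^esub>i\<in>A. (h \<circ> b) i)" by (rule hom_finprod[OF b_carr])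
      also have "\<dots> = (\<Otimes>\<^bsub>S\<^esub>i\<in>A. a i)"
        by (rule S.finprod_cong') (use a b A in auto)
      finally show "h (\<Otimes>\<^bsub>R\<^esub>i\<in>A. b i) = (\<Otimes>\<^bsub>S\<^esub>i\<in>A. a i)" .
    qed
    have "(\<Otimes>\<^bsub>R\<^esub>i\<in>{1..n+1}. b i) \<in> J"
      using prod mem_iff[OF lift(1)[OF order_refl]] lift(2)[OF order_refl] by simp
    then have "(\<Otimes>\<^bsub>R\<^esub>i\<in>{1..n}. b i) \<in> J \<or> b (n+1) \<in> J"
      using OA nonunit unfolding n_OA_ideal_def by blast
    moreover have "h (\<Otimes>\<^bsub>R\<^esub>i\<in>{1..n}. b i) = (\<Otimes>\<^bsub>S\<^esub>i\<in>{1..n}. a i)"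
      by (rule lift(2)) auto
    moreover have "h (b (n+1)) = a (n+1)" using b by simp
    ultimately show "(\<Otimes>\<^bsub>S\<^esub>i\<in>{1..n}. a i) \<in> h ` J \<or> a (n+1) \<in> h ` J"
      by (metis imageI)
  qed
qed

theorem (in ring_hom_cring) n_OAF_ring_surj_hom:
  assumes surj: "h ` carrier R = carrier S" and nontrivial: "\<one>\<^bsub>S\<^esub> \<noteq> \<zero>\<^bsub>S\<^esub>"
    and OAF: "n_OAF_ring n R"
  shows "n_OAF_ring n S"
  unfolding n_OAF_ring_def
proof (intro conjI allI impI)
  show "cring S" by (rule S.is_cring)
  show "\<one>\<^bsub>S\<^esub> \<noteq> \<zero>\<^bsub>S\<^esub>" by (rule nontrivial)
  fix K assume "proper_ideal K S"
  then have K: "ideal K S" "K \<noteq> carrier S" by (auto simp: proper_ideal_def)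
  interpret K: ideal K S by (rule K(1))
  define P where "P = {x \<in> carrier R. h x \<in> K}"
  have image_P: "h ` P = K"
  proof (intro equalityI subsetI)
    fix k assume k: "k \<in> K"
    then obtain x where "x \<in> carrier R" "k = h x"
      using surj K.a_subset by blast
    with k show "k \<in> h ` P" by (simp add: P_def)
  qed (auto simp: P_def)
  have "ideal P R" unfolding P_def by (rule ring.ideal_vimage[OF K(1)])
  moreover have "P \<noteq> carrier R" using image_P surj K(2) by metis
  ultimately have "proper_ideal P R" by (simp add: proper_ideal_def)
  then obtain Js where Js: "\<forall>J\<in>set Js. n_OA_ideal n J R" "P = ideal_list_prod R Js"
    using OAF unfolding n_OAF_ring_def by blast
  from Js(1) have ideals: "\<forall>J\<in>set Js. ideal J R"
    by (blast intro: n_OA_ideal_imp_ideal)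
  have "a_kernel R S h \<subseteq> P"
  proof
    fix x assume x: "x \<in> a_kernel R S h"
    then have "x \<in> carrier R" using ring.kernel_is_ideal ideal.Icarr by metis
    moreover have "h x \<in> K" using ring.kernel_zero[OF x] K.zero_closed by (rule ssubst)
    ultimately show "x \<in> P" by (simp add: P_def)
  qed
  have "n_OA_ideal n (h ` J) S" if J: "J \<in> set Js" for J
  proof (rule n_OA_ideal_hom_image[OF surj])
    show "n_OA_ideal n J R" using Js(1) J by blast
    have "P \<subseteq> J" using R.ideal_list_prod_subset_factor[OF ideals J] Js(2) by simp
    with \<open>a_kernel R S h \<subseteq> P\<close> show "a_kernel R S h \<subseteq> J" by (rule subset_trans)
  qed
  then have "\<forall>J\<in>set (map ((`) h) Js). n_OA_ideal n J S" by simp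
  moreover have "K = ideal_list_prod S (map ((`) h) Js)"
    using ring.hom_image_ideal_list_prod[OF surj ideals] image_P Js(2) by simp
  ultimately show "\<exists>Js. (\<forall>J\<in>set Js. n_OA_ideal n J S) \<and> K = ideal_list_prod S Js"
    by (intro exI conjI)
qed

theorem proposition2p11:
  fixes R :: "('a, 'b) ring_scheme" and I :: "'a set" and n :: nat
  assumes "n \<ge> 1" and "n_OAF_ring n R" and "proper_ideal I R"
  shows "n_OAF_ring n (R Quot I)"
proof -
  interpret R: cring R using assms(2) unfolding n_OAF_ring_def by blast
  interpret I: ideal I R using assms(3) unfolding proper_ideal_def by blast
  have "(+>\<^bsub>R\<^esub>) I ` carrier R = carrier (R Quot I)"
    by (auto simp: FactRing_def A_RCOSETS_def')
  moreover have "\<one>\<^bsub>R Quot I\<^esub> \<noteq> \<zero>\<^bsub>R Quot I\<^esub>"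
  proof
    assume "\<one>\<^bsub>R Quot I\<^esub> = \<zero>\<^bsub>R Quot I\<^esub>"
    then have "I +>\<^bsub>R\<^esub> \<one>\<^bsub>R\<^esub> = I" by (simp add: FactRing_def)
    then have "\<one>\<^bsub>R\<^esub> \<in> I" using I.a_rcos_self[OF R.one_closed] by simp
    then show False using I.one_imp_carrier assms(3) by (simp add: proper_ideal_def)
  qed
  ultimately show ?thesis
    using assms(2)
    by (rule ring_hom_cring.n_OAF_ring_surj_hom[OF I.rcos_ring_hom_cring[OF R.is_cring]])
qed

end
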